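(* (i) (Element level.) Let $I=[x_j,x_{j+1}]$, $\xi=(x-x_j)/(x_{j+1}-x_j)$, and let $\varphi_0=(1-\xi)(1-3\xi)$, $\varphi_1=6\xi(1-\xi)$, $\varphi_2=\xi(3\xi-2)$. With mass matrix $\mathtt{M}=(\int_I\varphi_i\varphi_l\,dx)_{i,l=0,1,2}$ and $Q=(\int_I\varphi_i\,\varphi_l'\,dx)_{i,l=0,1,2}$ one has $$Q=\begin{pmatrix}-\frac12&1&-\frac12\\-1&0&1\\ \frac12&-1&\frac12\end{pmatrix},\qquad Q+Q^T=\operatorname{diag}(-1,0,1),\qquad \mathtt{M}^{-1}Q\,\mathbf{1}=\mathbf{0},\quad \mathbf{1}=(1,1,1)^T .$$ (ii) (Global, periodic, central projection.) Consider a periodic uniform mesh with $N\ge3$ cells of size $\Delta x$, point values $u_j$ and cell averages $\bar u_{j+1/2}$ ($j\in\mathbb{Z}/N\mathbb{Z}$), ordered as $(\dots,\bar u_{j+1/2},u_{j+1},\bar u_{j+3/2},u_{j+2},\dots)$. Let $\tilde D$ be the $2N\times2N$ matrix of the third-order PamPa derivative operator with central projection, $$(\tilde D\mathbf{u})_{\bar u_{j+1/2}}=\frac{u_{j+1}-u_j}{\Delta x},\qquad (\tilde D\mathbf{u})_{u_{j+1}}=\frac{u_j-3\bar u_{j+1/2}+3\bar u_{j+3/2}-u_{j+2}}{\Delta x},$$ and let $\tilde{\mathbf{M}}$ be the diagonal matrix with entry $\frac{3\Delta x}{4}$ for each cell average and $\frac{\Delta x}{4}$ for each point value. Then $$\tilde{\mathbf{M}}\tilde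 D+(\tilde{\mathbf{M}}\tilde D)^T=0,$$ i.e. $\tilde D$ satisfies the periodic summation-by-parts property with norm matrix $\tilde{\mathbf{M}}$.
   Context: On $I$, a quadratic function is written $u_h=u_j\varphi_0+\bar u_{j+1/2}\varphi_1+u_{j+1}\varphi_2$, where $u_j,u_{j+1}$ are its end-point values and $\bar u_{j+1/2}$ its cell average. In the third-order PamPa scheme for $u_t+au_x=0$ with central projection, the semi-discrete system is $\frac{d\mathbf{u}}{dt}+a\tilde D\mathbf{u}=0$: averages are updated by the flux difference, and each point value is updated by the mean of the derivatives $u_h'(x_{j+1})$ computed in the two cells adjacent to $x_{j+1}$. The summation-by-parts (SBP) property for a derivative matrix $D$ and symmetric positive definite norm matrix $M$ means that $Q=MD$ satisfies $Q+Q^T=\operatorname{diag}(-1,0,\dots,0,1)$, and $Q+Q^T=0$ in the periodic case. *)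

theory Defs
  imports
    "HOL-Analysis.Analysis"
    "Jordan_Normal_Form.Gauss_Jordan_Elimination"
begin

text \<open>Vectors and matrices are those of \<^theory>\<open>Jordan_Normal_Form.Matrix\<close>, indexed from 0;
  the notions of the same name for type-indexed vectors are hidden.\<close>

hide_const (open) Finite_Cartesian_Product.mat Finite_Cartesian_Product.vec
  Finite_Cartesian_Product.transpose Finite_Cartesian_Product.row Finite_Cartesian_Product.column
unbundle no vec_syntax

definition phi :: "nat \<Rightarrow> real \<Rightarrow> real" where
  "phi i \<xi> = [(1 - \<xi>) * (1 - 3 * \<xi>), 6 * \<xi> * (1 - \<xi>), \<xi> * (3 * \<xi> - 2)] ! i"

definition basis :: "real \<Rightarrow> real \<Rightarrow> nat \<Rightarrow> real \<Rightarrow> real" where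
  "basis xl xr i x = phi i ((x - xl) / (xr - xl))"

definition mass_matrix :: "real \<Rightarrow> real \<Rightarrow> real mat" where
  "mass_matrix xl xr =
     mat 3 3 (\<lambda>(i, l). integral {xl..xr} (\<lambda>x. basis xl xr i x * basis xl xr l x))"

definition Q_matrix :: "real \<Rightarrow> real \<Rightarrow> real mat" where
  "Q_matrix xl xr =
     mat 3 3 (\<lambda>(i, l). integral {xl..xr} (\<lambda>x. basis xl xr i x * deriv (basis xl xr l) x))"

text \<open>Periodic mesh with \<open>N\<close> cells: an element of \<open>\<int>/N\<int>\<close> is represented by any integer \<open>j\<close>.
  The unknowns are ordered as
  \<open>\<bar>u\<^bsub>1/2\<^esub>, u\<^sub>1, \<bar>u\<^bsub>3/2\<^esub>, u\<^sub>2, \<dots>, \<bar>u\<^bsub>N-1/2\<^esub>, u\<^sub>N = u\<^sub>0\<close>,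
  so that the average over cell \<open>j\<close> has index \<open>2 j\<close> and the point value \<open>u\<^sub>j\<close> index \<open>2 (j - 1) + 1\<close>.\<close>

definition avg_idx :: "nat \<Rightarrow> int \<Rightarrow> nat" where
  "avg_idx N j = 2 * nat (j mod int N)"

definition pt_idx :: "nat \<Rightarrow> int \<Rightarrow> nat" where
  "pt_idx N j = 2 * nat ((j - 1) mod int N) + 1"

definition cell_avg :: "nat \<Rightarrow> real vec \<Rightarrow> int \<Rightarrow> real" where
  "cell_avg N u j = u $ avg_idx N j"

definition pt_val :: "nat \<Rightarrow> real vec \<Rightarrow> int \<Rightarrow> real" where
  "pt_val N u j = u $ pt_idx N j"

text \<open>The quadratic \<open>u\<^sub>h\<close> of cell \<open>j\<close>, with nodes \<open>x\<^sub>j = j \<Delta>x\<close>.  As a polynomial it is defined on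
  all of \<open>\<real>\<close>, hence \<^const>\<open>deriv\<close> at an end point of the cell is the one-sided derivative.\<close>

definition node :: "real \<Rightarrow> int \<Rightarrow> real" where
  "node dx j = of_int j * dx"

definition recon :: "nat \<Rightarrow> real \<Rightarrow> real vec \<Rightarrow> int \<Rightarrow> real \<Rightarrow> real" where
  "recon N dx u j x =
     pt_val N u j * basis (node dx j) (node dx (j + 1)) 0 x
   + cell_avg N u j * basis (node dx j) (node dx (j + 1)) 1 x
   + pt_val N u (j + 1) * basis (node dx j) (node dx (j + 1)) 2 x"

text \<open>Right-hand side of the scheme for \<open>u\<^sub>t + a u\<^sub>x = 0\<close>, without the factor \<open>- a\<close>: entry \<open>2 j\<close>
  is the flux difference over cell \<open>j\<close>, entry \<open>2 j + 1\<close> belongs to the point value \<open>u\<^bsub>j+1\<^esub>\<close>.\<close>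

definition pampa_central :: "nat \<Rightarrow> real \<Rightarrow> real vec \<Rightarrow> real vec" where
  "pampa_central N dx u = vec (2 * N) (\<lambda>r.
     let j = int (r div 2) in
     if even r then (pt_val N u (j + 1) - pt_val N u j) / dx
     else (deriv (recon N dx u j) (node dx (j + 1))
         + deriv (recon N dx u (j + 1)) (node dx (j + 1))) / 2)"

definition pampa_D :: "nat \<Rightarrow> real \<Rightarrow> real mat" where
  "pampa_D N dx =
     mat_of_cols (2 * N) (map (\<lambda>c. pampa_central N dx (unit_vec (2 * N) c)) [0..<2 * N])"

definition pampa_M :: "nat \<Rightarrow> real \<Rightarrow> real mat" where
  "pampa_M N dx = mat_diag (2 * N) (\<lambda>r. if even r then 3 * dx / 4 else dx / 4)"

definition sym_pos_def :: "nat \<Rightarrow> real mat \<Rightarrow> bool" where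
  "sym_pos_def n M \<longleftrightarrow> M \<in> carrier_mat n n \<and> transpose_mat M = M \<and>
     (\<forall>v \<in> carrier_vec n. v \<noteq> 0\<^sub>v n \<longrightarrow> v \<bullet> (M *\<^sub>v v) > 0)"

definition periodic_sbp :: "nat \<Rightarrow> real mat \<Rightarrow> real mat \<Rightarrow> bool" where
  "periodic_sbp n M D \<longleftrightarrow> sym_pos_def n M \<and> D \<in> carrier_mat n n \<and>
     M * D + transpose_mat (M * D) = 0\<^sub>m n n"

end

theory Submission
  imports Defs
begin

text \<open>
  On one cell, the affine map \<open>\<xi> = (x - x\<^sub>l) / (x\<^sub>r - x\<^sub>l)\<close> turns every entry of the mass matrix
  and of \<open>Q\<close> into the integral of a polynomial of degree at most four over \<open>[0, 1]\<close>
  (\<open>integral_quartic_on_cell\<close>).  In \<open>Q\<close> the Jacobian of the map cancels the factor from the chain rule,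
  so \<open>Q\<close> does not depend on the cell.  The mass matrix is \<open>(x\<^sub>r - x\<^sub>l)\<close> times a constant matrix with an
  explicit inverse.  The shape functions sum to 1, so the rows of \<open>Q\<close> sum to 0, and
  \<open>M\<^sup>-\<^sup>1 Q 1 = M\<^sup>-\<^sup>1 0 = 0\<close>.

  On the periodic mesh, averaging the two one-sided derivatives of the reconstructions at
  \<open>x\<^bsub>j+1\<^esub>\<close> cancels the contributions \<open>4 u\<^bsub>j+1\<^esub>\<close> and \<open>-4 u\<^bsub>j+1\<^esub>\<close>, which leaves the stated stencil
  (\<open>pampa_central_pt\<close>).  Every component of the scheme is a linear combination of entries of
  \<open>u\<close>, so the matrix built from the images of the unit vectors acts as the scheme itself
  (\<open>pampa_D_mult\<close>).  Summation by parts is then the statement that the matrix elements satisfy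
  \<open>m\<^sub>r D\<^sub>r\<^sub>c = - m\<^sub>c D\<^sub>c\<^sub>r\<close>.  Between two point values the stencil \<open>u\<^sub>j - u\<^bsub>j+2\<^esub>\<close> is centred on
  \<open>u\<^bsub>j+1\<^esub>\<close> and skew by itself, and two averages do not interact.  Between an average and a
  point value the coefficients are \<open>\<plusminus>1\<close> in one direction and \<open>\<minusplus>3\<close> in the other, which the
  weights \<open>3 \<Delta>x / 4\<close> and \<open>\<Delta>x / 4\<close> balance (\<open>pampa_MD_skew\<close>).
\<close>

section \<open>The reference element\<close>

definition dphi :: "nat \<Rightarrow> real \<Rightarrow> real" where
  "dphi i \<xi> = [6 * \<xi> - 4, 6 - 12 * \<xi>, 6 * \<xi> - 2] ! i"

lemma phi_has_derivative:
  assumes "i < 3"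
  shows "(phi i has_real_derivative dphi i \<xi>) (at \<xi>)"
proof -
  have "((\<lambda>\<xi>. (1 - \<xi>) * (1 - 3 * \<xi>)) has_real_derivative 6 * \<xi> - 4) (at \<xi>)"
    by (auto intro!: derivative_eq_intros simp: algebra_simps)
  moreover have "((\<lambda>\<xi>. 6 * \<xi> * (1 - \<xi>)) has_real_derivative 6 - 12 * \<xi>) (at \<xi>)"
    by (auto intro!: derivative_eq_intros simp: algebra_simps)
  moreover have "((\<lambda>\<xi>. \<xi> * (3 * \<xi> - 2)) has_real_derivative 6 * \<xi> - 2) (at \<xi>)"
    by (auto intro!: derivative_eq_intros simp: algebra_simps)
  moreover have "i = 0 \<or> i = 1 \<or> i = 2"
    using assms by auto
  ultimately show ?thesis
    by (auto simp: phi_def [abs_def] dphi_def)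
qed

lemma basis_has_derivative:
  assumes "i < 3" "xl < xr"
  shows "(basis xl xr i has_real_derivative dphi i ((x - xl) / (xr - xl)) / (xr - xl)) (at x)"
proof -
  have "((\<lambda>x. (x - xl) / (xr - xl)) has_real_derivative 1 / (xr - xl)) (at x)"
    using assms(2) by (auto intro!: derivative_eq_intros)
  from DERIV_chain2 [OF phi_has_derivative [OF assms(1)] this] show ?thesis
    by (simp add: basis_def [abs_def])
qed

lemmas deriv_basis = DERIV_imp_deriv [OF basis_has_derivative]

text \<open>The change of variables is built into the antiderivative \<open>h P((x - x\<^sub>l) / h)\<close>.  With general
  coefficients, each matrix entry reduces to expanding one product of polynomials in \<open>\<xi>\<close>.\<close>

lemma integral_quartic_on_cell:
  fixes xl xr :: real
  assumes "xl < xr"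
    and f: "\<And>x. f x = (let \<xi> = (x - xl) / (xr - xl) in
                  c0 + c1 * \<xi> + c2 * \<xi>^2 + c3 * \<xi>^3 + c4 * \<xi>^4)"
  shows "integral {xl..xr} f = (xr - xl) * (c0 + c1 / 2 + c2 / 3 + c3 / 4 + c4 / 5)"
proof -
  define h where "h = xr - xl"
  define P where "P \<xi> = c0 * \<xi> + c1 * \<xi>^2 / 2 + c2 * \<xi>^3 / 3 + c3 * \<xi>^4 / 4 + c4 * \<xi>^5 / 5" for \<xi>
  have h: "h > 0"
    using assms by (simp add: h_def)
  have P: "(P has_real_derivative c0 + c1 * \<xi> + c2 * \<xi>^2 + c3 * \<xi>^3 + c4 * \<xi>^4) (at \<xi>)" for \<xi>
    unfolding P_def by (auto intro!: derivative_eq_intros)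
  have "((\<lambda>x. h * P ((x - xl) / h)) has_real_derivative f x) (at x)" for x
  proof -
    have "((\<lambda>x. (x - xl) / h) has_real_derivative 1 / h) (at x)"
      using h by (auto intro!: derivative_eq_intros)
    from DERIV_cmult [OF DERIV_chain2 [OF P this], of h] show ?thesis
      using h by (simp add: f Let_def h_def [symmetric])
  qed
  then have "((\<lambda>x. h * P ((x - xl) / h)) has_vector_derivative f x) (at x within {xl..xr})" for x
    by (simp add: has_real_derivative_iff_has_vector_derivative has_vector_derivative_at_within)
  then have "(f has_integral (h * P ((xr - xl) / h) - h * P ((xl - xl) / h))) {xl..xr}"
    by (rule fundamental_theorem_of_calculus [OF less_imp_le [OF assms(1)]])
  moreover have "h * P ((xr - xl) / h) - h * P ((xl - xl) / h)
      = (xr - xl) * (c0 + c1 / 2 + c2 / 3 + c3 / 4 + c4 / 5)"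
    using h by (simp add: P_def h_def)
  ultimately show ?thesis
    by (metis integral_unique)
qed

lemma Q_matrix_eq:
  assumes "xl < xr"
  shows "Q_matrix xl xr = mat_of_rows_list 3
    [[-1/2, 1, -1/2], [-1, 0, 1], [1/2, -1, 1/2]]"
proof -
  define h where "h = xr - xl"
  have h: "h > 0"
    using assms by (simp add: h_def)
  have entry: "integral {xl..xr} (\<lambda>x. basis xl xr i x * deriv (basis xl xr l) x)
      = c0 + c1 / 2 + c2 / 3 + c3 / 4"
    if "l < 3" and eq: "\<And>\<xi>. phi i \<xi> * dphi l \<xi> = c0 + c1 * \<xi> + c2 * \<xi>^2 + c3 * \<xi>^3"
    for i l c0 c1 c2 c3
  proof -
    have "integral {xl..xr} (\<lambda>x. basis xl xr i x * deriv (basis xl xr l) x)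
        = (xr - xl) * (c0 / h + c1 / h / 2 + c2 / h / 3 + c3 / h / 4 + 0 / 5)"
    proof (rule integral_quartic_on_cell [OF assms])
      fix x
      show "basis xl xr i x * deriv (basis xl xr l) x
        = (let \<xi> = (x - xl) / (xr - xl) in
            c0 / h + c1 / h * \<xi> + c2 / h * \<xi>^2 + c3 / h * \<xi>^3 + 0 * \<xi>^4)"
        using eq [of "(x - xl) / (xr - xl)"]
        by (simp add: deriv_basis [OF \<open>l < 3\<close> assms] basis_def Let_def h_def [symmetric]
            add_divide_distrib)
    qed
    also have "\<dots> = c0 + c1 / 2 + c2 / 3 + c3 / 4"
      using h by (simp add: h_def [symmetric] field_simps)
    finally show ?thesis .
  qed
  note [simp] = phi_def dphi_def
  have 1: "integral {xl..xr} (\<lambda>x. basis xl xr 0 x * deriv (basis xl xr 0) x) = -1/2"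
    by (subst entry [of _ _ "-4" 22 "-36" 18]) (simp_all add: algebra_simps power_numeral_reduce)
  have 2: "integral {xl..xr} (\<lambda>x. basis xl xr 0 x * deriv (basis xl xr 1) x) = 1"
    by (subst entry [of _ _ 6 "-36" 66 "-36"]) (simp_all add: algebra_simps power_numeral_reduce)
  have 3: "integral {xl..xr} (\<lambda>x. basis xl xr 0 x * deriv (basis xl xr 2) x) = -1/2"
    by (subst entry [of _ _ "-2" 14 "-30" 18]) (simp_all add: algebra_simps power_numeral_reduce)
  have 4: "integral {xl..xr} (\<lambda>x. basis xl xr 1 x * deriv (basis xl xr 0) x) = -1"
    by (subst entry [of _ _ 0 "-24" 60 "-36"]) (simp_all add: algebra_simps power_numeral_reduce)
  have 5: "integral {xl..xr} (\<lambda>x. basis xl xr 1 x * deriv (basis xl xr 1) x) = 0"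
    by (subst entry [of _ _ 0 36 "-108" 72]) (simp_all add: algebra_simps power_numeral_reduce)
  have 6: "integral {xl..xr} (\<lambda>x. basis xl xr 1 x * deriv (basis xl xr 2) x) = 1"
    by (subst entry [of _ _ 0 "-12" 48 "-36"]) (simp_all add: algebra_simps power_numeral_reduce)
  have 7: "integral {xl..xr} (\<lambda>x. basis xl xr 2 x * deriv (basis xl xr 0) x) = 1/2"
    by (subst entry [of _ _ 0 8 "-24" 18]) (simp_all add: algebra_simps power_numeral_reduce)
  have 8: "integral {xl..xr} (\<lambda>x. basis xl xr 2 x * deriv (basis xl xr 1) x) = -1"
    by (subst entry [of _ _ 0 "-12" 42 "-36"]) (simp_all add: algebra_simps power_numeral_reduce)
  have 9: "integral {xl..xr} (\<lambda>x. basis xl xr 2 x * deriv (basis xl xr 2) x) = 1/2"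
    by (subst entry [of _ _ 0 4 "-18" 18]) (simp_all add: algebra_simps power_numeral_reduce)
  show ?thesis
    using 1 2 3 4 5 6 7 8 9
    by (intro eq_matI)
      (auto simp: Q_matrix_def mat_of_rows_list_def less_Suc_eq numeral_3_eq_3 numeral_2_eq_2)
qed

lemma mass_matrix_eq:
  assumes "xl < xr"
  shows "mass_matrix xl xr = ((xr - xl) / 30) \<cdot>\<^sub>m mat_of_rows_list 3
    [[4, -3, -1], [-3, 36, -3], [-1, -3, 4]]"
proof -
  define h where "h = xr - xl"
  have entry: "integral {xl..xr} (\<lambda>x. basis xl xr i x * basis xl xr l x)
      = h / 30 * (30 * c0 + 15 * c1 + 10 * c2 + 15 * c3 / 2 + 6 * c4)"
    if eq: "\<And>\<xi>. phi i \<xi> * phi l \<xi> = c0 + c1 * \<xi> + c2 * \<xi>^2 + c3 * \<xi>^3 + c4 * \<xi>^4"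
    for i l c0 c1 c2 c3 c4
  proof -
    have "integral {xl..xr} (\<lambda>x. basis xl xr i x * basis xl xr l x)
        = (xr - xl) * (c0 + c1 / 2 + c2 / 3 + c3 / 4 + c4 / 5)"
      by (rule integral_quartic_on_cell [OF assms]) (simp only: basis_def eq Let_def)
    then show ?thesis
      by (simp add: h_def [symmetric] field_simps)
  qed
  note [simp] = phi_def
  have 1: "integral {xl..xr} (\<lambda>x. basis xl xr 0 x * basis xl xr 0 x) = h / 30 * 4"
    by (subst entry [of _ _ 1 "-8" 22 "-24" 9]) (simp_all add: algebra_simps power_numeral_reduce)
  have 2: "integral {xl..xr} (\<lambda>x. basis xl xr 0 x * basis xl xr 1 x) = h / 30 * (-3)"
    by (subst entry [of _ _ 0 6 "-30" 42 "-18"]) (simp_all add: algebra_simps power_numeral_reduce)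
  have 3: "integral {xl..xr} (\<lambda>x. basis xl xr 0 x * basis xl xr 2 x) = h / 30 * (-1)"
    by (subst entry [of _ _ 0 "-2" 11 "-18" 9]) (simp_all add: algebra_simps power_numeral_reduce)
  have 4: "integral {xl..xr} (\<lambda>x. basis xl xr 1 x * basis xl xr 1 x) = h / 30 * 36"
    by (subst entry [of _ _ 0 0 36 "-72" 36]) (simp_all add: algebra_simps power_numeral_reduce)
  have 5: "integral {xl..xr} (\<lambda>x. basis xl xr 1 x * basis xl xr 2 x) = h / 30 * (-3)"
    by (subst entry [of _ _ 0 0 "-12" 30 "-18"]) (simp_all add: algebra_simps power_numeral_reduce)
  have 6: "integral {xl..xr} (\<lambda>x. basis xl xr 2 x * basis xl xr 2 x) = h / 30 * 4"
    by (subst entry [of _ _ 0 0 4 "-12" 9]) (simp_all add: algebra_simps power_numeral_reduce)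
  note all = 1 2 3 4 5 6 2 [unfolded mult.commute [of "basis xl xr 0 _"]]
    3 [unfolded mult.commute [of "basis xl xr 0 _"]] 5 [unfolded mult.commute [of "basis xl xr 1 _"]]
  show ?thesis
    using all unfolding h_def [symmetric]
    by (intro eq_matI)
      (auto simp: mass_matrix_def mat_of_rows_list_def less_Suc_eq numeral_3_eq_3 numeral_2_eq_2)
qed

lemma mass_matrix_invertible:
  assumes "xl < xr"
  shows "\<exists>B. mat_inverse (mass_matrix xl xr) = Some B \<and> B \<in> carrier_mat 3 3"
proof -
  let ?M = "mass_matrix xl xr"
  define h where "h = xr - xl"
  have h: "h > 0"
    using assms by (simp add: h_def)
  have M: "?M \<in> carrier_mat 3 3"
    by (simp add: mass_matrix_def)
  \<comment> \<open>\<open>B\<close> is the adjugate of the mass matrix divided by its determinant.\<close>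
  define B :: "real mat" where
    "B = (1 / h) \<cdot>\<^sub>m mat_of_rows_list 3 [[9, 1, 3], [1, 1, 1], [3, 1, 9]]"
  have B: "B \<in> carrier_mat 3 3"
    by (simp add: B_def mat_of_rows_list_def numeral_3_eq_3)
  have "?M * B = 1\<^sub>m 3" "B * ?M = 1\<^sub>m 3"
    using h unfolding mass_matrix_eq [OF assms] B_def h_def [symmetric]
    by (intro eq_matI; auto simp: mat_of_rows_list_def scalar_prod_def less_Suc_eq numeral_3_eq_3)+
  then have "?M \<in> Units (ring_mat TYPE(real) 3 ())"
    using M B by (auto simp: Units_def ring_mat_def)
  then show ?thesis
    using mat_inverse(1) [OF M, where b = "()"] mat_inverse(2) [OF M] by (cases "mat_inverse ?M") auto
qed

section \<open>The stencil on the periodic mesh\<close>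

lemma deriv_recon:
  assumes "dx > 0"
  shows "deriv (recon N dx u j) x =
    (pt_val N u j * dphi 0 ((x - node dx j) / dx) + cell_avg N u j * dphi 1 ((x - node dx j) / dx)
     + pt_val N u (j + 1) * dphi 2 ((x - node dx j) / dx)) / dx"
proof -
  have w: "node dx (j + 1) - node dx j = dx" and l: "node dx j < node dx (j + 1)"
    using assms by (simp_all add: node_def algebra_simps)
  show ?thesis
    unfolding recon_def [abs_def]
    by (rule DERIV_imp_deriv, rule DERIV_cong [OF DERIV_add [OF DERIV_add
        [OF DERIV_cmult [OF basis_has_derivative [OF _ l]]
            DERIV_cmult [OF basis_has_derivative [OF _ l]]]
         DERIV_cmult [OF basis_has_derivative [OF _ l]]]])
      (simp_all add: w add_divide_distrib)
qed

lemma pt_idx_less: "N > 0 \<Longrightarrow> pt_idx N j < 2 * N"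
  and avg_idx_less: "N > 0 \<Longrightarrow> avg_idx N j < 2 * N"
proof -
  assume "N > 0"
  then have "nat (i mod int N) < N" for i
    by (simp add: nat_less_iff)
  from this [of j] this [of "j - 1"] show "pt_idx N j < 2 * N" "avg_idx N j < 2 * N"
    by (simp_all add: pt_idx_def avg_idx_def)
qed

text \<open>The row index determines the cell only up to a multiple of \<open>N\<close>, and the row is computed at
  the representative in \<open>{0..<N}\<close>; the unknowns are periodic in \<open>j\<close>.\<close>

lemma cell_avg_mod: "cell_avg N u (j mod int N + k) = cell_avg N u (j + k)"
  and pt_val_mod: "pt_val N u (j mod int N + k) = pt_val N u (j + k)"
proof -
  have "(j mod int N + k - 1) mod int N = (j + k - 1) mod int N"
    using mod_add_left_eq [of j "int N" "k - 1"] by (simp add: algebra_simps)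
  then show "pt_val N u (j mod int N + k) = pt_val N u (j + k)"
    by (simp add: pt_val_def pt_idx_def)
qed (simp add: cell_avg_def avg_idx_def mod_add_left_eq)

lemma pampa_central_avg:
  assumes "N > 0"
  shows "pampa_central N dx u $ avg_idx N j = (pt_val N u (j + 1) - pt_val N u j) / dx"
  using assms avg_idx_less [OF assms, of j] pt_val_mod [of N u j 0] pt_val_mod [of N u j 1]
  by (simp add: pampa_central_def avg_idx_def)

lemma pampa_central_pt:
  assumes "N > 0" "dx > 0"
  shows "pampa_central N dx u $ pt_idx N (j + 1) =
    (pt_val N u j - 3 * cell_avg N u j + 3 * cell_avg N u (j + 1) - pt_val N u (j + 2)) / dx"
proof -
  define i where "i = j mod int N"
  have idx: "pt_idx N (j + 1) = 2 * nat i + 1" and i: "i \<ge> 0"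
    using assms by (simp_all add: pt_idx_def i_def)
  have nodes: "(node dx (i + 1) - node dx i) / dx = 1"
    "(node dx (i + 1) - node dx (i + 1)) / dx = 0"
    using assms by (simp_all add: node_def algebra_simps)
  have "pampa_central N dx u $ pt_idx N (j + 1) =
    (deriv (recon N dx u i) (node dx (i + 1)) + deriv (recon N dx u (i + 1)) (node dx (i + 1))) / 2"
    using pt_idx_less [OF assms(1), of "j + 1"]
    by (simp add: pampa_central_def idx i Let_def)
  also have "\<dots> = (pt_val N u i - 3 * cell_avg N u i + 3 * cell_avg N u (i + 1) - pt_val N u (i + 2)) / dx"
    unfolding deriv_recon [OF assms(2)] nodes
    using assms by (simp add: dphi_def field_simps)
  also have "\<dots> = (pt_val N u j - 3 * cell_avg N u j + 3 * cell_avg N u (j + 1) - pt_val N u (j + 2)) / dx"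
    using pt_val_mod [of N u j 0] pt_val_mod [of N u j 2]
      cell_avg_mod [of N u j 0] cell_avg_mod [of N u j 1]
    by (simp add: i_def)
  finally show ?thesis .
qed

lemma index_cases:
  assumes "r < 2 * N"
  obtains (avg) j where "r = avg_idx N j" | (pt) j where "r = pt_idx N (j + 1)"
proof (cases "even r")
  case True
  then have "r = avg_idx N (int (r div 2))"
    using assms by (simp add: avg_idx_def)
  then show ?thesis by (rule avg)
next
  case False
  then have "r = pt_idx N (int (r div 2) + 1)"
    using assms by (auto simp: pt_idx_def elim!: oddE)
  then show ?thesis by (rule pt)
qed

section \<open>The derivative matrix\<close>

lemma pampa_D_carrier: "pampa_D N dx \<in> carrier_mat (2 * N) (2 * N)"
  by (simp add: pampa_D_def mat_of_cols_def)

lemma pampa_M_carrier: "pampa_M N dx \<in> carrier_mat (2 * N) (2 * N)"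
  by (simp add: pampa_M_def)

lemma pampa_D_index:
  assumes "r < 2 * N" "c < 2 * N"
  shows "pampa_D N dx $$ (r, c) = pampa_central N dx (unit_vec (2 * N) c) $ r"
  using assms by (simp add: pampa_D_def mat_of_cols_index)

lemma pampa_D_mult:
  assumes "N > 0" "dx > 0" and u: "u \<in> carrier_vec (2 * N)"
  shows "pampa_D N dx *\<^sub>v u = pampa_central N dx u"
proof (rule eq_vecI)
  let ?e = "unit_vec (2 * N) :: nat \<Rightarrow> real vec"
  fix r
  assume "r < dim_vec (pampa_central N dx u)"
  then have r: "r < 2 * N"
    by (simp add: pampa_central_def)
  have row: "(pampa_D N dx *\<^sub>v u) $ r = (\<Sum>c<2 * N. pampa_central N dx (?e c) $ r * u $ c)"
    using r u pampa_D_carrier [of N dx]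
    by (auto simp: scalar_prod_def pampa_D_index atLeast0LessThan intro!: sum.cong)
  have coord: "(\<Sum>c<2 * N. ?e c $ k * u $ c) = u $ k" if "k < 2 * N" for k
  proof -
    have "(\<Sum>c<2 * N. ?e c $ k * u $ c) = (\<Sum>c<2 * N. if k = c then u $ c else 0)"
      using that by (intro sum.cong) (auto simp: unit_vec_def)
    then show ?thesis
      using that by simp
  qed
  have pt_sum: "(\<Sum>c<2 * N. pt_val N (?e c) j * u $ c) = pt_val N u j"
    and avg_sum: "(\<Sum>c<2 * N. cell_avg N (?e c) j * u $ c) = cell_avg N u j" for j
    unfolding pt_val_def cell_avg_def by (rule coord, simp add: assms(1) pt_idx_less avg_idx_less)+
  from r show "(pampa_D N dx *\<^sub>v u) $ r = pampa_central N dx u $ r"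
  proof (cases rule: index_cases)
    case (avg j)
    have "(\<Sum>c<2 * N. (pt_val N (?e c) (j + 1) - pt_val N (?e c) j) / dx * u $ c)
      = ((\<Sum>c<2 * N. pt_val N (?e c) (j + 1) * u $ c) - (\<Sum>c<2 * N. pt_val N (?e c) j * u $ c)) / dx"
      by (simp add: sum_subtractf [symmetric] sum_divide_distrib algebra_simps diff_divide_distrib)
    then show ?thesis
      unfolding row unfolding avg pampa_central_avg [OF assms(1)] pt_sum .
  next
    case (pt j)
    have "(\<Sum>c<2 * N. (pt_val N (?e c) j - 3 * cell_avg N (?e c) j + 3 * cell_avg N (?e c) (j + 1)
          - pt_val N (?e c) (j + 2)) / dx * u $ c)
      = ((\<Sum>c<2 * N. pt_val N (?e c) j * u $ c) - 3 * (\<Sum>c<2 * N. cell_avg N (?e c) j * u $ c)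
         + 3 * (\<Sum>c<2 * N. cell_avg N (?e c) (j + 1) * u $ c)
         - (\<Sum>c<2 * N. pt_val N (?e c) (j + 2) * u $ c)) / dx"
      by (simp add: sum_subtractf [symmetric] sum.distrib [symmetric] sum_distrib_left
          sum_divide_distrib algebra_simps diff_divide_distrib add_divide_distrib)
    then show ?thesis
      unfolding row unfolding pt pampa_central_pt [OF assms(1,2)] pt_sum avg_sum .
  qed
qed (use pampa_D_carrier [of N dx] in \<open>auto simp: pampa_central_def\<close>)

section \<open>Skew-symmetry\<close>

lemma unit_vec_stencil:
  fixes i k :: int
  assumes "N > 0"
  shows "pt_val N (unit_vec (2 * N) (pt_idx N k)) i = of_bool (int N dvd i - k)"
    and "pt_val N (unit_vec (2 * N) (avg_idx N k)) i = 0"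
    and "cell_avg N (unit_vec (2 * N) (pt_idx N k)) i = 0"
    and "cell_avg N (unit_vec (2 * N) (avg_idx N k)) i = of_bool (int N dvd i - k)"
proof -
  have parity: "pt_idx N a \<noteq> avg_idx N b" for a b
    by (metis avg_idx_def pt_idx_def double_not_eq_Suc_double Suc_eq_plus1)
  have nat_mod: "nat (a mod int N) = nat (b mod int N) \<longleftrightarrow> int N dvd a - b" for a b
    using assms by (simp add: eq_nat_nat_iff mod_eq_dvd_iff)
  have "pt_idx N i = pt_idx N k \<longleftrightarrow> int N dvd i - k"
    using nat_mod [of "i - 1" "k - 1"] by (simp add: pt_idx_def)
  moreover have "avg_idx N i = avg_idx N k \<longleftrightarrow> int N dvd i - k"
    using nat_mod [of i k] by (simp add: avg_idx_def)
  ultimately show "pt_val N (unit_vec (2 * N) (pt_idx N k)) i = of_bool (int N dvd i - k)"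
    "pt_val N (unit_vec (2 * N) (avg_idx N k)) i = 0"
    "cell_avg N (unit_vec (2 * N) (pt_idx N k)) i = 0"
    "cell_avg N (unit_vec (2 * N) (avg_idx N k)) i = of_bool (int N dvd i - k)"
    using assms parity parity [symmetric]
    by (simp_all add: pt_val_def cell_avg_def unit_vec_def pt_idx_less avg_idx_less)
qed

lemma pampa_MD_index:
  assumes "r < 2 * N" "c < 2 * N"
  shows "(pampa_M N dx * pampa_D N dx) $$ (r, c) =
    (if even r then 3 * dx / 4 else dx / 4) * pampa_central N dx (unit_vec (2 * N) c) $ r"
  using assms pampa_D_carrier [of N dx]
  by (simp add: pampa_M_def mat_diag_mult_left [of _ "2 * N" "2 * N"] pampa_D_index)

text \<open>The weights cancel the \<open>\<Delta>x\<close> in the stencils, so each matrix element is a combination of indicators of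
  \<open>N dvd i - k + s\<close> for shifts \<open>s\<close>; transposing exchanges \<open>i\<close> and \<open>k\<close>, and divisibility is invariant
  under a change of sign.\<close>

lemma pampa_MD_skew:
  assumes "N > 0" "dx > 0" "r < 2 * N" "c < 2 * N"
  shows "(pampa_M N dx * pampa_D N dx) $$ (r, c) = - (pampa_M N dx * pampa_D N dx) $$ (c, r)"
proof -
  have even_avg: "even (avg_idx N j)" and odd_pt: "odd (pt_idx N j)" for j
    by (simp_all add: avg_idx_def pt_idx_def)
  have swap: "int N dvd a - b \<longleftrightarrow> int N dvd b - a" for a b
    by (rule dvd_diff_commute)
  note entries = pampa_MD_index [OF assms(3,4)] pampa_MD_index [OF assms(4,3)]
  note stencil = pampa_central_avg [OF assms(1)] pampa_central_pt [OF assms(1,2)]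
    unit_vec_stencil [OF assms(1)] even_avg odd_pt
  from assms(3) show ?thesis
  proof (cases rule: index_cases)
    case r: (avg i)
    from assms(4) show ?thesis
    proof (cases rule: index_cases)
      case c: (avg k)
      show ?thesis
        unfolding entries unfolding r c by (simp add: stencil)
    next
      case c: (pt k)
      show ?thesis
        unfolding entries unfolding r c
        using assms(2) swap [of i k] swap [of i "k + 1"] by (simp add: stencil)
    qed
  next
    case r: (pt i)
    from assms(4) show ?thesis
    proof (cases rule: index_cases)
      case c: (avg k)
      show ?thesis
        unfolding entries unfolding r c
        using assms(2) swap [of k i] swap [of k "i + 1"] by (simp add: stencil)
    next
      case c: (pt k)
      have "int N dvd i + 2 - (k + 1) \<longleftrightarrow> int N dvd k - (i + 1)"
        "int N dvd k + 2 - (i + 1) \<longleftrightarrow> int N dvd i - (k + 1)"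
        using swap [of "i + 1" k] swap [of "k + 1" i] by (simp_all add: algebra_simps)
      then show ?thesis
        unfolding entries unfolding r c using assms(2) by (simp add: stencil)
    qed
  qed
qed

lemma pampa_skew_symmetric:
  assumes "N > 0" "dx > 0"
  shows "pampa_M N dx * pampa_D N dx + transpose_mat (pampa_M N dx * pampa_D N dx)
    = 0\<^sub>m (2 * N) (2 * N)"
proof -
  define A where "A = pampa_M N dx * pampa_D N dx"
  have "A \<in> carrier_mat (2 * N) (2 * N)"
    unfolding A_def using pampa_M_carrier pampa_D_carrier by (rule mult_carrier_mat)
  moreover have "A $$ (r, c) + A $$ (c, r) = 0" if "r < 2 * N" "c < 2 * N" for r c
    unfolding A_def eq_neg_iff_add_eq_0 [symmetric] by (rule pampa_MD_skew [OF assms that])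
  ultimately show ?thesis
    unfolding A_def [symmetric] by (intro eq_matI) auto
qed

lemma pampa_M_sym_pos_def:
  assumes "dx > 0"
  shows "sym_pos_def (2 * N) (pampa_M N dx)"
  unfolding sym_pos_def_def
proof (intro conjI ballI impI)
  let ?m = "\<lambda>r::nat. if even r then 3 * dx / 4 else dx / 4"
  show "pampa_M N dx \<in> carrier_mat (2 * N) (2 * N)"
    by (rule pampa_M_carrier)
  show "transpose_mat (pampa_M N dx) = pampa_M N dx"
    by (rule eq_matI) (auto simp: pampa_M_def mat_diag_def)
  fix v :: "real vec"
  assume v: "v \<in> carrier_vec (2 * N)" "v \<noteq> 0\<^sub>v (2 * N)"
  then obtain k where k: "k < 2 * N" "v $ k \<noteq> 0"
    by (metis carrier_vecD eq_vecI index_zero_vec)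
  have "(pampa_M N dx *\<^sub>v v) $ r = ?m r * v $ r" if "r < 2 * N" for r
    using that v
    by (simp add: pampa_M_def mat_diag_def scalar_prod_def if_distrib [of "\<lambda>x. x * _"] cong: if_cong)
  then have "v \<bullet> (pampa_M N dx *\<^sub>v v) = (\<Sum>r<2 * N. ?m r * (v $ r)^2)"
    using pampa_M_carrier [of N dx]
    by (auto simp: scalar_prod_def atLeast0LessThan power2_eq_square intro!: sum.cong)
  also have "\<dots> > 0"
    by (rule sum_pos2 [of _ k]) (use k assms in auto)
  finally show "v \<bullet> (pampa_M N dx *\<^sub>v v) > 0" .
qed

theorem mainTheorem4:
  shows
    "(\<forall>xl xr. xl < xr \<longrightarrow>
        Q_matrix xl xr = mat_of_rows_list 3
          [[-1/2,  1, -1/2],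
           [  -1,  0,    1],
           [ 1/2, -1,  1/2]]
      \<and> Q_matrix xl xr + transpose_mat (Q_matrix xl xr) = mat_diag 3 (\<lambda>i. [-1, 0, 1] ! i)
      \<and> (\<exists>Minv. mat_inverse (mass_matrix xl xr) = Some Minv
            \<and> (Minv * Q_matrix xl xr) *\<^sub>v vec 3 (\<lambda>_. 1) = 0\<^sub>v 3))
   \<and> (\<forall>N dx. N \<ge> 3 \<longrightarrow> dx > 0 \<longrightarrow>
        (\<forall>u \<in> carrier_vec (2 * N). \<forall>j :: int.
            (pampa_D N dx *\<^sub>v u) $ avg_idx N j = (pt_val N u (j + 1) - pt_val N u j) / dx
          \<and> (pampa_D N dx *\<^sub>v u) $ pt_idx N (j + 1) =
              (pt_val N u j - 3 * cell_avg N u j + 3 * cell_avg N u (j + 1) - pt_val N u (j + 2)) / dx)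
      \<and> pampa_M N dx * pampa_D N dx + transpose_mat (pampa_M N dx * pampa_D N dx) = 0\<^sub>m (2 * N) (2 * N)
      \<and> periodic_sbp (2 * N) (pampa_M N dx) (pampa_D N dx))"
proof (intro conjI allI impI ballI)
  fix xl xr :: real
  assume less: "xl < xr"
  show "Q_matrix xl xr = mat_of_rows_list 3 [[-1/2, 1, -1/2], [-1, 0, 1], [1/2, -1, 1/2]]"
    by (rule Q_matrix_eq [OF less])
  show "Q_matrix xl xr + transpose_mat (Q_matrix xl xr) = mat_diag 3 (\<lambda>i. [-1, 0, 1] ! i)"
    unfolding Q_matrix_eq [OF less]
    by (rule eq_matI)
      (auto simp: mat_of_rows_list_def mat_diag_def less_Suc_eq numeral_3_eq_3)
  obtain B where B: "mat_inverse (mass_matrix xl xr) = Some B" "B \<in> carrier_mat 3 3"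
    using mass_matrix_invertible [OF less] by blast
  have "Q_matrix xl xr *\<^sub>v vec 3 (\<lambda>_. 1) = 0\<^sub>v 3"
    unfolding Q_matrix_eq [OF less]
    by (rule eq_vecI)
      (auto simp: mat_of_rows_list_def scalar_prod_def less_Suc_eq numeral_3_eq_3)
  moreover have "Q_matrix xl xr \<in> carrier_mat 3 3"
    by (simp add: Q_matrix_def)
  ultimately have "(B * Q_matrix xl xr) *\<^sub>v vec 3 (\<lambda>_. 1) = B *\<^sub>v 0\<^sub>v 3"
    using B(2) by (metis assoc_mult_mat_vec vec_carrier)
  also have "\<dots> = 0\<^sub>v 3"
    using B(2) by (auto intro!: eq_vecI)
  finally show "\<exists>Minv. mat_inverse (mass_matrix xl xr) = Some Minv
      \<and> (Minv * Q_matrix xl xr) *\<^sub>v vec 3 (\<lambda>_. 1) = 0\<^sub>v 3"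
    using B(1) by blast
next
  fix N :: nat and dx :: real
  assume "N \<ge> 3" and dx: "dx > 0"
  then have N: "N > 0"
    by simp
  show skew: "pampa_M N dx * pampa_D N dx + transpose_mat (pampa_M N dx * pampa_D N dx)
      = 0\<^sub>m (2 * N) (2 * N)"
    by (rule pampa_skew_symmetric [OF N dx])
  show "periodic_sbp (2 * N) (pampa_M N dx) (pampa_D N dx)"
    unfolding periodic_sbp_def
    using pampa_M_sym_pos_def [OF dx] pampa_D_carrier skew by blast
  fix u :: "real vec" and j :: int
  assume "u \<in> carrier_vec (2 * N)"
  note D = pampa_D_mult [OF N dx this]
  show "(pampa_D N dx *\<^sub>v u) $ avg_idx N j = (pt_val N u (j + 1) - pt_val N u j) / dx"
    unfolding D by (rule pampa_central_avg [OF N])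
  show "(pampa_D N dx *\<^sub>v u) $ pt_idx N (j + 1) =
      (pt_val N u j - 3 * cell_avg N u j + 3 * cell_avg N u (j + 1) - pt_val N u (j + 2)) / dx"
    unfolding D by (rule pampa_central_pt [OF N dx])
qed

end
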